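(* Let $p$ and $q$ be odd prime numbers with $p = 2q+1$, and let $A = \dfrac{p^q-1}{p-1}$. Then exactly one of the distinct prime divisors of $A$ is less than $p$, and $A$ has at least two different prime divisors. *)

theory Defs
  imports Complex_Main "HOL-Computational_Algebra.Primes"
begin

end

theory Submission
  imports Defs "HOL-Number_Theory.Number_Theory"
begin

text \<open>
  Write \<open>A = 1 + p + \<dots> + p^(q-1)\<close>. A prime divisor \<open>r\<close> of \<open>A\<close> for which \<open>p\<close> has order 1
  divides \<open>q\<close>, as then \<open>A\<close> is congruent to \<open>q\<close> modulo \<open>r\<close>; if the order is \<open>q\<close>, then \<open>2q\<close>
  divides \<open>r - 1\<close>, so \<open>r\<close> is at least \<open>p\<close>. Since \<open>p = 1 + 2q\<close>, expanding the sum modulo \<open>q\<^sup>2\<close>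
  shows that \<open>A\<close> is congruent to \<open>q\<close>, so \<open>q\<close> divides \<open>A\<close> exactly once; as \<open>A > q\<close>, some other
  prime must divide \<open>A\<close> too.
\<close>

lemma power_eq_geometric_sum:
  fixes y :: nat
  shows "(y + 1) ^ n = y * (\<Sum>i<n. (y + 1) ^ i) + 1"
  by (induction n) (simp_all add: algebra_simps)

lemma geometric_sum_nat:
  fixes y :: nat
  assumes "y > 0"
  shows "((y + 1) ^ n - 1) div y = (\<Sum>i<n. (y + 1) ^ i)"
  using assms by (subst power_eq_geometric_sum) simp

lemma geometric_sum_cong_1:
  fixes x m :: nat
  assumes "[x = 1] (mod m)"
  shows "[(\<Sum>i<n. x ^ i) = n] (mod m)"
proof -
  have "[(\<Sum>i<n. x ^ i) = (\<Sum>i<n. 1 ^ i)] (mod m)"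
    using assms by (intro cong_sum cong_pow)
  then show ?thesis
    by simp
qed

text \<open>In the binomial expansion every term beyond the linear one carries the factor
  \<open>b\<^sup>2\<close>.\<close>

lemma one_plus_power_cong_square:
  fixes a b :: nat
  shows "[(a * b + 1) ^ i = 1 + a * b * i] (mod b\<^sup>2)"
proof (induction i)
  case (Suc i)
  have "[(a * b + 1) * (a * b + 1) ^ i = (a * b + 1) * (1 + a * b * i)] (mod b\<^sup>2)"
    using Suc by (rule cong_scalar_left)
  also have "(a * b + 1) * (1 + a * b * i) = 1 + a * b * Suc i + b\<^sup>2 * (a\<^sup>2 * i)"
    by (simp add: algebra_simps power2_eq_square)
  also have "[\<dots> = 1 + a * b * Suc i] (mod b\<^sup>2)"
    by (simp add: cong_def)
  finally show ?case
    by simp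
qed simp

lemma geometric_sum_cong_square:
  fixes q :: nat
  shows "[(\<Sum>i<q. (2 * q + 1) ^ i) = q] (mod q\<^sup>2)"
proof -
  have "[(\<Sum>i<q. (2 * q + 1) ^ i) = (\<Sum>i<q. 1 + 2 * q * i)] (mod q\<^sup>2)"
    by (intro cong_sum one_plus_power_cong_square)
  \<comment> \<open>The number of terms \<open>n\<close> is kept apart from the coefficient
    \<open>q\<close>, so that induction on \<open>n\<close> leaves \<open>q\<close> fixed;
    afterwards \<open>n\<close> is set to \<open>q\<close>.\<close>
  also have "(\<Sum>i<n. 1 + 2 * q * i) = n + q * (n * (n - 1))" for n
  proof (induction n)
    case (Suc n)
    then show ?case
      by (cases n) (simp_all add: algebra_simps)
  qed simp
  also have "q + q * (q * (q - 1)) = q + q\<^sup>2 * (q - 1)"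
    by (simp add: power2_eq_square)
  also have "[\<dots> = q] (mod q\<^sup>2)"
    by (simp add: cong_def)
  finally show ?thesis .
qed

lemma prime_dvd_geometric_sum_cases:
  fixes q r x :: nat
  assumes "prime q" "prime r" "x > 1" and dvd: "r dvd (\<Sum>i<q. x ^ i)"
  shows "r = q \<or> q dvd r - 1"
proof -
  have eq: "x ^ q = (\<Sum>i<q. x ^ i) * (x - 1) + 1"
    using power_eq_geometric_sum[of "x - 1" q] \<open>x > 1\<close> by (simp add: mult.commute)
  have "[(\<Sum>i<q. x ^ i) * (x - 1) + 1 = 0 + 1] (mod r)"
    using dvd by (intro cong_add cong_refl) (simp add: cong_0_iff)
  with eq have "[x ^ q = 1] (mod r)"
    by simp
  then have "ord r x dvd q"
    by (rule ord_divides[THEN iffD1])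
  \<comment> \<open>Only for \<open>x\<close> coprime to \<open>r\<close> does its order divide
    \<open>totient r\<close>, which is \<open>r - 1\<close>.\<close>
  have "coprime (x ^ q) r"
    using \<open>[x ^ q = 1] (mod r)\<close> cong_imp_coprime[OF cong_sym] coprime_1_left by blast
  then have cop: "coprime r x"
    using \<open>prime q\<close> by (simp add: coprime_commute prime_gt_0_nat)
  from \<open>ord r x dvd q\<close> consider "ord r x = 1" | "ord r x = q"
    using \<open>prime q\<close> prime_nat_iff by blast
  then show ?thesis
  proof cases
    case 1
    then have "[x = 1] (mod r)"
      using ord_divides[of x 1 r] by simp
    then have "r dvd q"
      using geometric_sum_cong_1 dvd cong_dvd_iff by blast
    then show ?thesis
      using assms primes_dvd_imp_eq by blast
  next
    case 2
    then show ?thesis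
      using order_divides_totient[OF cop] \<open>prime r\<close> by (simp add: totient_prime)
  qed
qed

theorem theorem1:
  fixes p q A :: nat
  assumes "prime p" and "odd p"
    and "prime q" and "odd q"
    and "p = 2 * q + 1"
    and "A = (p ^ q - 1) div (p - 1)"
  shows "(\<exists>!r. r \<in> prime_factors A \<and> r < p) \<and> card (prime_factors A) \<ge> 2"
proof -
  have q: "q > 2"
    using \<open>prime q\<close> \<open>odd q\<close> prime_ge_2_nat[of q] by (cases "q = 2") auto
  have A: "A = (\<Sum>i<q. p ^ i)"
    using assms q geometric_sum_nat[of "2 * q" q] by simp
  have "[A = q] (mod q\<^sup>2)"
    using geometric_sum_cong_square A assms by simp
  \<comment> \<open>If \<open>q\<^sup>2\<close> divided \<open>A\<close>, it would divide
    \<open>q\<close>, which is smaller and positive.\<close>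
  then have "q dvd A" and not_sq: "\<not> q\<^sup>2 dvd A"
    using q cong_dvd_iff[of A q "q\<^sup>2"] cong_dvd_iff[of A q q]
    by (auto simp: power2_eq_square cong_modulus_mult_nat dest: dvd_imp_le)
  \<comment> \<open>The term for \<open>i = 1\<close> alone already exceeds
    \<open>q\<close>.\<close>
  have "p ^ 1 \<le> A"
    unfolding A using q by (intro member_le_sum) auto
  then have "A > q"
    using assms by simp
  have "q < p"
    using assms by simp
  have "A \<noteq> 0"
    using \<open>A > q\<close> by simp
  have small: "r = q" if "r \<in> prime_factors A" "r < p" for r
  proof (rule ccontr)
    assume "r \<noteq> q"
    have "prime r" "r dvd A"
      using that by auto
    then have "q dvd r - 1"
      using prime_dvd_geometric_sum_cases[of q r p] \<open>r \<noteq> q\<close> assms A q by auto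
    \<comment> \<open>For \<open>r = 2\<close> the number \<open>q > 2\<close> would divide 1. With
      \<open>r\<close> odd, the coprime numbers 2 and \<open>q\<close> both divide
      \<open>r - 1\<close>, which forces \<open>r\<close> to be at least \<open>p\<close>.\<close>
    moreover have "r \<noteq> 2"
      using \<open>q dvd r - 1\<close> q by auto
    then have "odd r"
      using \<open>prime r\<close> prime_odd_nat[of r] prime_ge_2_nat[of r] by auto
    then have "2 dvd r - 1"
      by simp
    ultimately have "2 * q dvd r - 1"
      using \<open>odd q\<close> by (intro divides_mult) auto
    then show False
      using \<open>r < p\<close> assms \<open>prime r\<close> prime_ge_2_nat[of r] by (auto dest: dvd_imp_le)
  qed
  have q_in: "q \<in> prime_factors A"
    using \<open>q dvd A\<close> \<open>A \<noteq> 0\<close> \<open>prime q\<close> by (simp add: prime_factors_dvd)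
  obtain m where m: "A = q * m"
    using \<open>q dvd A\<close> by blast
  with \<open>A > q\<close> have "m \<noteq> 1"
    by auto
  \<comment> \<open>A second prime is sought in the cofactor \<open>m\<close>: it cannot be
    \<open>q\<close>, since \<open>q\<^sup>2\<close> does not divide \<open>A\<close>.\<close>
  then obtain r where r: "prime r" "r dvd m"
    using prime_factor_nat by blast
  then have "r \<noteq> q"
    using not_sq m by (auto simp: power2_eq_square)
  have "r \<in> prime_factors A"
    using r m \<open>A \<noteq> 0\<close> by (simp add: prime_factors_dvd)
  with q_in have "card {q, r} \<le> card (prime_factors A)"
    by (intro card_mono) auto
  with \<open>r \<noteq> q\<close> have "card (prime_factors A) \<ge> 2"
    by simp
  moreover have "\<exists>!r. r \<in> prime_factors A \<and> r < p"
    using q_in small \<open>q < p\<close> by blast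
  ultimately show ?thesis
    by blast
qed

end
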